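(* Let $n$ be a positive integer and $0\le k\le\lfloor n/2\rfloor$. The expected value, over the uniform distribution on Seidel matrices $S$ of tournaments of order $n$, of the coefficient $c_{2k}$ of $x^{n-2k}$ in the characteristic polynomial $\det(xI-S)$ equals the number of matchings of size $k$ (i.e., with exactly $k$ edges) in the complete graph $K_n$, namely $\binom{n}{2k}(2k-1)!!$. Consequently, the expected characteristic polynomial is $\sum_{k=0}^{\lfloor n/2\rfloor}\binom{n}{2k}(2k-1)!!\,x^{n-2k}$.
   Context: A tournament of order $n$ is a digraph on $\{1,\dots,n\}$ with exactly one of the arcs $ij$, $ji$ for each pair $i\ne j$. Its Seidel matrix $S=[s_{ij}]$ is the $n\times n$ skew-symmetric matrix with zero diagonal, $s_{ij}=1$ if $ij$ is an arc and $s_{ij}=-1$ otherwise; all $2^{\binom n2}$ are equally likely. A matching is a set of pairwise vertex-disjoint edges. $(-1)!!=1!!=1$, $m!!=m(m-2)!!$. *)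

theory Defs
  imports
    "HOL-Probability.Probability"
    "Graph_Theory.Pair_Digraph"
    "Jordan_Normal_Form.Char_Poly"
begin

definition tournament :: "nat \<Rightarrow> nat pair_pre_digraph \<Rightarrow> bool" where
  "tournament n T \<longleftrightarrow> pair_digraph T \<and> pverts T = {1..n} \<and>
     (\<forall>i\<in>{1..n}. \<forall>j\<in>{1..n}. i \<noteq> j \<longrightarrow> ((i, j) \<in> parcs T) \<noteq> ((j, i) \<in> parcs T))"

text \<open>Matrix indices start at 0 and vertices at 1: row and column \<open>i\<close> belong to vertex \<open>Suc i\<close>.\<close>

definition seidel_matrix :: "nat \<Rightarrow> nat pair_pre_digraph \<Rightarrow> real mat" where
  "seidel_matrix n T = mat n n (\<lambda>(i, j).
     if i = j then 0 else if (Suc i, Suc j) \<in> parcs T then 1 else - 1)"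

definition seidel_matrices :: "nat \<Rightarrow> real mat set" where
  "seidel_matrices n = seidel_matrix n ` {T. tournament n T}"

text \<open>The uniform distribution \<open>pmf_of_set\<close> is meaningful only on a finite nonempty set, which
  the next two lemmas provide.\<close>

lemma finite_seidel_matrices: "finite (seidel_matrices n)"
proof -
  have "tournament n T \<Longrightarrow> parcs T \<subseteq> {1..n} \<times> {1..n}" for T
    unfolding tournament_def
    using pair_wf_digraph.wellformed' pair_digraph.axioms(1) pair_fin_digraph.axioms(1)
    by (metis SigmaI subrelI)
  then have "parcs ` {T. tournament n T} \<subseteq> Pow ({1..n} \<times> {1..n})"
    by blast
  then have "finite (parcs ` {T. tournament n T})"
    by (rule finite_subset) simp
  moreover have "seidel_matrices n = (\<lambda>A. mat n n (\<lambda>(i, j).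
      if i = j then 0 else if (Suc i, Suc j) \<in> A then 1 else - 1)) ` parcs ` {T. tournament n T}"
    unfolding seidel_matrices_def seidel_matrix_def image_image by (rule refl)
  ultimately show ?thesis
    by simp
qed

lemma seidel_matrices_nonempty: "seidel_matrices n \<noteq> {}"
proof -
  let ?A = "{(i, j). i \<in> {1..n} \<and> j \<in> {1..n} \<and> i < j}"
  let ?T = "\<lparr> pverts = {1..n}, parcs = ?A \<rparr>"
  have fin: "finite ?A"
    by (rule finite_subset[of _ "{1..n} \<times> {1..n}"]) auto
  have wf: "pair_wf_digraph ?T"
    by (rule pair_wf_digraph.intro) (simp_all add: case_prod_beta)
  have "pair_digraph ?T"
    by (intro pair_digraph.intro pair_fin_digraph.intro pair_fin_digraph_axioms.intro
      pair_loopfree_digraph.intro pair_loopfree_digraph_axioms.intro wf)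
      (use fin in \<open>simp_all add: case_prod_beta\<close>)
  then have "tournament n ?T"
    unfolding tournament_def by (simp add: nat_neq_iff)
  then show ?thesis
    unfolding seidel_matrices_def by blast
qed

definition random_seidel :: "nat \<Rightarrow> real mat pmf" where
  "random_seidel n = pmf_of_set (seidel_matrices n)"

text \<open>Expectation of a polynomial-valued random variable on a finitely supported distribution.
  The Bochner integral is not available, as polynomials are not an instance of \<open>banach\<close>.\<close>

definition expected_poly :: "'a pmf \<Rightarrow> ('a \<Rightarrow> real poly) \<Rightarrow> real poly" where
  "expected_poly p f = (\<Sum>\<omega>\<in>set_pmf p. Polynomial.smult (pmf p \<omega>) (f \<omega>))"

definition complete_graph_edges :: "nat \<Rightarrow> nat set set" where
  "complete_graph_edges n = {e. e \<subseteq> {1..n} \<and> card e = 2}"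

definition is_matching :: "'a set set \<Rightarrow> 'a set set \<Rightarrow> bool" where
  "is_matching E M \<longleftrightarrow> M \<subseteq> E \<and> pairwise disjnt M"

text \<open>The argument is an integer so that \<open>(-1)!! = 1\<close> can be expressed.\<close>

function double_fact :: "int \<Rightarrow> nat" where
  "double_fact m = (if m \<le> 1 then 1 else nat m * double_fact (m - 2))"
  by pat_completeness auto
termination
  by (relation "Wellfounded.measure nat") auto

declare double_fact.simps [simp del]

end

theory Submission
  imports Defs
begin

text \<open>
  Expand \<open>det (xI - S)\<close> over permutations. If \<open>p (p i) \<noteq> i\<close> for some \<open>i\<close>, reversing the arc
  between \<open>i\<close> and \<open>p i\<close> negates the term of \<open>p\<close>, so its average vanishes. The involutions remain:
  each transposition contributes \<open>- s\<^sub>i\<^sub>j s\<^sub>j\<^sub>i = 1\<close> and each fixed point contributes \<open>x\<close>. Involutions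
  correspond to matchings, and matchings are counted by removing a vertex.
\<close>

text \<open>The vertex set is arbitrary because the counting recursion deletes vertices. Later
  instances are \<open>{1..n}\<close>, for the vertices of the complete graph, and
  \<open>{0..<n}\<close>, for the matrix indices.\<close>

abbreviation edges_on :: "'a set \<Rightarrow> 'a set set" where
  "edges_on V \<equiv> {e. e \<subseteq> V \<and> card e = 2}"

abbreviation matchings_on :: "'a set \<Rightarrow> 'a set set set" where
  "matchings_on V \<equiv> {M. is_matching (edges_on V) M}"

abbreviation involutions_on :: "'a set \<Rightarrow> ('a \<Rightarrow> 'a) set" where
  "involutions_on V \<equiv> {p. p permutes V \<and> (\<forall>x. p (p x) = x)}"

subsection \<open>Counting matchings\<close>

lemma finite_matchings_on:
  assumes "finite V" shows "finite (matchings_on V)"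
proof (rule finite_subset)
  show "matchings_on V \<subseteq> Pow (Pow V)"
    by (auto simp: is_matching_def)
qed (use assms in simp)

lemma finite_matching:
  assumes "finite V" "M \<in> matchings_on V" shows "finite M"
  using assms by (auto simp: is_matching_def intro: finite_subset[of M "Pow V"])

lemma card_Union_matching:
  assumes "finite V" "M \<in> matchings_on V"
  shows "card (\<Union>M) = 2 * card M"
proof -
  have M: "e \<subseteq> V" "card e = 2" if "e \<in> M" for e
    using that assms(2) by (auto simp: is_matching_def)
  have "card (\<Union>M) = sum card M"
    using assms(2) M(1) assms(1)
    by (intro card_Union_disjoint) (auto simp: is_matching_def intro: finite_subset)
  also have "\<dots> = 2 * card M"
    using M(2) by simp
  finally show ?thesis .
qed

lemma card_matching_le:
  assumes "finite V" "M \<in> matchings_on V"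
  shows "2 * card M \<le> card V"
proof -
  have "\<Union>M \<subseteq> V"
    using assms(2) by (auto simp: is_matching_def)
  then show ?thesis
    using card_Union_matching[OF assms] card_mono[OF assms(1)] by metis
qed

lemma matching_edge_unique:
  assumes "is_matching E M" "e \<in> M" "f \<in> M" "x \<in> e" "x \<in> f"
  shows "e = f"
  using assms by (metis (no_types) disjnt_iff is_matching_def pairwiseD)

lemma is_matching_insert:
  assumes "e \<notin> M"
  shows "is_matching E (insert e M) \<longleftrightarrow> is_matching E M \<and> e \<in> E \<and> e \<inter> \<Union>M = {}"
  using assms by (auto simp: is_matching_def pairwise_insert disjnt_def)

text \<open>Shrinks the ground set: an edge inside \<open>W \<union> U\<close> that misses
  \<open>U - W\<close> already lies inside \<open>W\<close>, while disjointness of edges does not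
  depend on the ground set.\<close>

lemma matchings_on_avoiding:
  "is_matching (edges_on W) M \<longleftrightarrow> is_matching (edges_on (W \<union> U)) M \<and> \<Union>M \<inter> (U - W) = {}"
  unfolding is_matching_def by blast

text \<open>Either \<open>v\<close> is uncovered, or it has a partner \<open>u\<close>; in the
  latter case removing the edge \<open>{v, u}\<close> leaves a matching of size \<open>k\<close>
  that avoids both \<open>v\<close> and \<open>u\<close>.\<close>

lemma matchings_insert_vertex:
  assumes v: "v \<notin> V" and fin: "finite V"
  shows "{M \<in> matchings_on (insert v V). card M = Suc k} =
    {M \<in> matchings_on V. card M = Suc k} \<union>
    (\<Union>u\<in>V. insert {v, u} ` {M \<in> matchings_on (V - {u}). card M = k})" (is "?L = ?A \<union> ?B")
proof (intro equalityI subsetI)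
  fix M assume M: "M \<in> ?L"
  then have mM: "is_matching (edges_on (insert v V)) M"
    by simp
  have finM: "finite M"
    using M finite_matching[of "insert v V"] fin by auto
  show "M \<in> ?A \<union> ?B"
  proof (cases "v \<in> \<Union>M")
    case False
    have "is_matching (edges_on V) M"
      using mM False matchings_on_avoiding[of V M "{v}"] by auto
    then show ?thesis
      using M by simp
  next
    case True
    then obtain e where e: "e \<in> M" "v \<in> e"
      by blast
    then have e2: "e \<subseteq> insert v V" "card e = 2"
      using mM by (auto simp: is_matching_def)
    then obtain u where u: "e = {v, u}" "u \<noteq> v"
      using e(2) by (auto simp: card_2_iff)
    then have uV: "u \<in> V"
      using e2 by auto
    define N where "N = M - {e}"
    have MN: "M = insert e N" "e \<notin> N"
      using e(1) by (auto simp: N_def)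
    then have N: "is_matching (edges_on (insert v V)) N" "e \<inter> \<Union>N = {}"
      using mM is_matching_insert by metis+
    \<comment> \<open>Written in the form \<open>W \<union> U\<close> of
      \<open>matchings_on_avoiding\<close>, with \<open>W = V - {u}\<close> and
      \<open>U = {v, u}\<close>.\<close>
    have "insert v V = (V - {u}) \<union> {v, u}"
      using uV by auto
    then have "is_matching (edges_on (V - {u})) N"
      using N u(1) matchings_on_avoiding[of "V - {u}" N "{v, u}"] by auto
    moreover have "card N = k"
      using M MN finM by simp
    ultimately show ?thesis
      using uV MN u(1) by blast
  qed
next
  fix M assume "M \<in> ?A \<union> ?B"
  then show "M \<in> ?L"
  proof
    assume "M \<in> ?A"
    then show ?thesis
      by (auto simp: is_matching_def)
  next
    assume "M \<in> ?B"
    then obtain u N where u: "u \<in> V" and N: "N \<in> matchings_on (V - {u})" "card N = k"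
      and M: "M = insert {v, u} N"
      by blast
    have "finite N"
      using finite_matching[OF _ N(1)] fin by simp
    have UN: "\<Union>N \<subseteq> V - {u}"
      using N(1) by (auto simp: is_matching_def)
    then have "{v, u} \<notin> N"
      by blast
    moreover have "is_matching (edges_on (insert v V)) N"
      using N(1) by (auto simp: is_matching_def)
    moreover have "{v, u} \<in> edges_on (insert v V)"
      using u v by (auto simp: card_2_iff)
    moreover have "{v, u} \<inter> \<Union>N = {}"
      using UN v by auto
    ultimately show ?thesis
      using M N(2) \<open>finite N\<close> by (simp add: is_matching_insert)
  qed
qed

text \<open>Nothing is counted twice: only the second kind of matching covers \<open>v\<close>, the
  partner \<open>u\<close> is determined by the matching, and \<open>{v, u}\<close> is never already
  an edge of a matching on \<open>V - {u}\<close>, so inserting it is injective.\<close>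

lemma card_matchings_insert_vertex:
  assumes v: "v \<notin> V" and fin: "finite V"
  shows "card {M \<in> matchings_on (insert v V). card M = Suc k} =
    card {M \<in> matchings_on V. card M = Suc k} +
    (\<Sum>u\<in>V. card {M \<in> matchings_on (V - {u}). card M = k})"
proof -
  let ?A = "{M \<in> matchings_on V. card M = Suc k}"
  let ?C = "\<lambda>u. {M \<in> matchings_on (V - {u}). card M = k}"
  let ?B = "\<lambda>u. insert {v, u} ` ?C u"
  have vC: "v \<notin> \<Union>M" if "M \<in> matchings_on W" "v \<notin> W" for M W
    using that by (auto simp: is_matching_def)
  have finC: "finite (?C u)" for u
    using finite_matchings_on[of "V - {u}"] fin by simp
  have inj: "inj_on (insert {v, u}) (?C u)" for u
  proof (rule inj_onI)
    fix M N assume MN: "M \<in> ?C u" "N \<in> ?C u" "insert {v, u} M = insert {v, u} N"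
    have "{v, u} \<notin> M" "{v, u} \<notin> N"
      using vC[of M "V - {u}"] vC[of N "V - {u}"] MN(1,2) v by blast+
    then show "M = N"
      using MN(3) by (simp add: insert_ident)
  qed
  have "card (?A \<union> (\<Union>u\<in>V. ?B u)) = card ?A + card (\<Union>u\<in>V. ?B u)"
  proof (rule card_Un_disjoint)
    show "?A \<inter> (\<Union>u\<in>V. ?B u) = {}"
      using vC[of _ V] v by fastforce
  qed (use finite_matchings_on[of V] fin finC in simp_all)
  also have "card (\<Union>u\<in>V. ?B u) = (\<Sum>u\<in>V. card (?B u))"
  proof (rule card_UN_disjoint)
    have "u = w" if "M \<in> ?B u" "M \<in> ?B w" for u w M
    proof -
      obtain N where N: "N \<in> ?C w" "M = insert {v, w} N"
        using \<open>M \<in> ?B w\<close> by blast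
      have "{v, u} \<in> M"
        using \<open>M \<in> ?B u\<close> by blast
      moreover have "{v, u} \<notin> N"
        using vC[of N "V - {w}"] N(1) v by blast
      ultimately show ?thesis
        using N(2) by (auto simp: doubleton_eq_iff)
    qed
    then show "\<forall>u\<in>V. \<forall>w\<in>V. u \<noteq> w \<longrightarrow> ?B u \<inter> ?B w = {}"
      by (metis (no_types, lifting) disjoint_iff)
  qed (use fin finC in simp_all)
  also have "(\<Sum>u\<in>V. card (?B u)) = (\<Sum>u\<in>V. card (?C u))"
    by (rule sum.cong[OF refl]) (rule card_image[OF inj])
  finally show ?thesis
    by (simp only: matchings_insert_vertex[OF assms])
qed

text \<open>For \<open>k = 0\<close> both arguments, 1 and -1, fall under the base clause, so the
  recursive clause applies only to positive \<open>k\<close>.\<close>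

lemma double_fact_Suc:
  "double_fact (2 * int (Suc k) - 1) = (2 * k + 1) * double_fact (2 * int k - 1)"
proof (cases k)
  case 0
  then show ?thesis
    by (simp add: double_fact.simps)
next
  case (Suc j)
  then show ?thesis
    by (subst double_fact.simps) (simp add: nat_add_distrib nat_mult_distrib algebra_simps)
qed

text \<open>With \<open>m + 1\<close> vertices, removing one gives a(m+1, j+1) = a(m, j+1) + m
  a(m-1, j). The closed form satisfies this recursion by absorption and Pascal's rule. Since
  \<open>k\<close> drops as well, the induction on \<open>card V\<close> keeps it arbitrary.\<close>

lemma card_matchings_on:
  assumes "finite V"
  shows "card {M \<in> matchings_on V. card M = k} =
    (card V choose (2 * k)) * double_fact (2 * int k - 1)"
  using assms
proof (induction "card V" arbitrary: V k rule: less_induct)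
  case less
  show ?case
  proof (cases k)
    case 0
    have "{M \<in> matchings_on V. card M = 0} = {{}}"
      using finite_matching[OF less.prems] by (auto simp: is_matching_def)
    then show ?thesis
      using 0 by (simp add: double_fact.simps)
  next
    case (Suc j)
    show ?thesis
    proof (cases "V = {}")
      case True
      have "{M \<in> matchings_on V. card M = k} = {}"
        using card_matching_le[OF less.prems] True Suc by fastforce
      then have "card {M \<in> matchings_on V. card M = k} = 0"
        by (simp only: card.empty)
      then show ?thesis
        using True Suc by simp
    next
      case False
      then obtain v where "v \<in> V"
        by blast
      define W where "W = V - {v}"
      have W: "V = insert v W" "v \<notin> W" "finite W"
        using \<open>v \<in> V\<close> less.prems by (auto simp: W_def)
      define m where "m = card W"
      have cV: "card V = Suc m"
        using W by (simp add: m_def)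
      let ?d = "double_fact (2 * int j - 1)"
      have "card {M \<in> matchings_on V. card M = k} = card {M \<in> matchings_on W. card M = Suc j} +
          (\<Sum>u\<in>W. card {M \<in> matchings_on (W - {u}). card M = j})"
        unfolding W(1) Suc by (rule card_matchings_insert_vertex[OF W(2,3)])
      also have "card {M \<in> matchings_on W. card M = Suc j} =
          (m choose (2 * Suc j)) * double_fact (2 * int (Suc j) - 1)"
        unfolding m_def using less.hyps[of W "Suc j"] W(3) cV m_def by simp
      \<comment> \<open>The truncated \<open>m - 1\<close> is harmless: for \<open>m = 0\<close> the
        sum is empty.\<close>
      also have "(\<Sum>u\<in>W. card {M \<in> matchings_on (W - {u}). card M = j}) =
          (\<Sum>u\<in>W. ((m - 1) choose (2 * j)) * ?d)"
      proof (rule sum.cong[OF refl])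
        fix u assume "u \<in> W"
        then have "card (W - {u}) = m - 1"
          using W(3) by (simp add: m_def)
        then show "card {M \<in> matchings_on (W - {u}). card M = j} = ((m - 1) choose (2 * j)) * ?d"
          using less.hyps[of "W - {u}" j] W(3) cV by simp
      qed
      also have "\<dots> = m * ((m - 1) choose (2 * j)) * ?d"
        by (simp add: m_def)
      \<comment> \<open>Absorption produces the factor \<open>2 * j + 1\<close> of the next double
        factorial; Pascal's rule then merges the two binomials with lower indices
        \<open>2 * j + 1\<close> and \<open>2 * j + 2\<close>.\<close>
      also have "m * ((m - 1) choose (2 * j)) = (m choose (2 * j + 1)) * (2 * j + 1)"
        using binomial_absorption[of "2 * j" m] by (simp add: mult.commute)
      finally show ?thesis
        unfolding cV Suc double_fact_Suc by (simp add: algebra_simps)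
    qed
  qed
qed

subsection \<open>Involutions and matchings\<close>

text \<open>The permutation swapping the two ends of every edge. The description is proper when
  \<open>M\<close> is a matching, since a covered vertex then has exactly one partner.\<close>

definition matching_involution :: "'a set set \<Rightarrow> 'a \<Rightarrow> 'a" where
  "matching_involution M x = (if x \<in> \<Union>M then THE y. {x, y} \<in> M else x)"

lemma matching_involution_edge:
  assumes "M \<in> matchings_on V" "{x, y} \<in> M"
  shows "matching_involution M x = y"
proof -
  have "z = y" if "{x, z} \<in> M" for z
    using matching_edge_unique[of "edges_on V" M "{x, y}" "{x, z}" x] assms that
    by (auto simp: doubleton_eq_iff)
  then have "(THE y. {x, y} \<in> M) = y"
    using assms(2) by (intro the_equality)
  then show ?thesis
    using assms(2) unfolding matching_involution_def by auto
qed

lemma matching_covered_edge: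
  assumes "M \<in> matchings_on V" "x \<in> \<Union>M"
  obtains y where "{x, y} \<in> M" "y \<noteq> x"
proof -
  obtain e where e: "e \<in> M" "x \<in> e"
    using assms(2) by blast
  then have "card e = 2"
    using assms(1) by (auto simp: is_matching_def)
  then obtain y where "e = {x, y}" "y \<noteq> x"
    using e(2) by (auto simp: card_2_iff)
  then show ?thesis
    using that e(1) by blast
qed

lemma matching_involution_fixed:
  assumes "M \<in> matchings_on V"
  shows "matching_involution M x = x \<longleftrightarrow> x \<notin> \<Union>M"
  using matching_covered_edge[OF assms, of x] matching_involution_edge[OF assms]
  by (metis matching_involution_def)

lemma matching_involution_in:
  assumes "M \<in> matchings_on V"
  shows "matching_involution M \<in> involutions_on V"
proof -
  let ?p = "matching_involution M"
  have inv: "?p (?p x) = x" for x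
  proof (cases "x \<in> \<Union>M")
    case True
    then obtain y where "{x, y} \<in> M"
      using matching_covered_edge[OF assms] by blast
    moreover from this have "{y, x} \<in> M"
      by (simp add: insert_commute)
    ultimately show ?thesis
      using matching_involution_edge[OF assms] by simp
  qed (simp add: matching_involution_def)
  moreover have "?p x = x" if "x \<notin> V" for x
  proof -
    have "x \<notin> \<Union>M"
      using assms that by (auto simp: is_matching_def)
    then show ?thesis
      by (simp add: matching_involution_def)
  qed
  moreover have "\<exists>!x. ?p x = y" for y
    using inv by metis
  ultimately show ?thesis
    by (simp add: permutes_def)
qed

text \<open>The inverse map sends an involution to the set of its 2-cycles, each obtained twice,
  from either of its two elements.\<close>

lemma bij_betw_matching_involution:
  "bij_betw matching_involution (matchings_on V) (involutions_on V)"
proof (rule bij_betw_byWitness[where f' = "\<lambda>p. {{i, p i} |i. p i \<noteq> i}"])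
  show "\<forall>M\<in>matchings_on V.
    {{i, matching_involution M i} |i. matching_involution M i \<noteq> i} = M"
  proof (intro ballI equalityI subsetI)
    fix M e assume M: "M \<in> matchings_on V"
      and "e \<in> {{i, matching_involution M i} |i. matching_involution M i \<noteq> i}"
    then obtain i where i: "e = {i, matching_involution M i}" "i \<in> \<Union>M"
      using matching_involution_fixed[OF M] by blast
    then show "e \<in> M"
      using matching_covered_edge[OF M i(2)] matching_involution_edge[OF M] by metis
  next
    fix M e assume M: "M \<in> matchings_on V" and e: "e \<in> M"
    then have "card e = 2"
      by (auto simp: is_matching_def)
    then obtain i j where ij: "e = {i, j}" "i \<noteq> j"
      by (auto simp: card_2_iff)
    then have "matching_involution M i = j"
      using matching_involution_edge[OF M] e by simp
    then show "e \<in> {{i, matching_involution M i} |i. matching_involution M i \<noteq> i}"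
      using ij by (auto intro!: exI[of _ i])
  qed
  have edges: "{{i, p i} |i. p i \<noteq> i} \<in> matchings_on V" if "p \<in> involutions_on V" for p
  proof -
    have p: "p permutes V" "p (p x) = x" for x
      using that by auto
    have "{{i, p i} |i. p i \<noteq> i} \<subseteq> edges_on V"
    proof clarify
      fix i assume i: "p i \<noteq> i"
      then have "i \<in> V"
        using p(1) by (meson permutes_not_in)
      then show "{i, p i} \<subseteq> V \<and> card {i, p i} = 2"
        using i permutes_in_image[OF p(1)] by auto
    qed
    moreover have "pairwise disjnt {{i, p i} |i. p i \<noteq> i}"
    proof (rule pairwiseI)
      fix e f assume "e \<in> {{i, p i} |i. p i \<noteq> i}" "f \<in> {{i, p i} |i. p i \<noteq> i}" "e \<noteq> f"
      then obtain i j where ij: "e = {i, p i}" "f = {j, p j}" "e \<noteq> f"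
        by blast
      \<comment> \<open>Any coincidence would make the two cycles equal, because \<open>p\<close> is
        its own inverse.\<close>
      have "i \<noteq> j" "i \<noteq> p j" "p i \<noteq> j" "p i \<noteq> p j"
        using ij p(2) by (metis insert_commute)+
      then show "disjnt e f"
        unfolding ij(1,2) by (simp add: disjnt_def)
    qed
    ultimately show ?thesis
      by (simp add: is_matching_def)
  qed
  show "\<forall>p\<in>involutions_on V. matching_involution {{i, p i} |i. p i \<noteq> i} = p"
  proof (intro ballI ext)
    fix p x assume p: "p \<in> involutions_on V"
    show "matching_involution {{i, p i} |i. p i \<noteq> i} x = p x"
    proof (cases "p x = x")
      case False
      then show ?thesis
        using matching_involution_edge[OF edges[OF p]] by blast
    next
      case True
      have "x \<notin> \<Union>{{i, p i} |i. p i \<noteq> i}"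
        using True p by auto
      then show ?thesis
        using matching_involution_fixed[OF edges[OF p], of x] True by simp
    qed
  qed
  show "matching_involution ` matchings_on V \<subseteq> involutions_on V"
    using matching_involution_in by blast
  show "(\<lambda>p. {{i, p i} |i. p i \<noteq> i}) ` involutions_on V \<subseteq> matchings_on V"
    using edges by blast
qed

lemma card_fixed_matching_involution:
  assumes "finite V" "M \<in> matchings_on V"
  shows "card {i \<in> V. matching_involution M i = i} = card V - 2 * card M"
proof -
  have "{i \<in> V. matching_involution M i = i} = V - \<Union>M"
    using matching_involution_fixed[OF assms(2)] by blast
  moreover have "\<Union>M \<subseteq> V"
    using assms(2) by (auto simp: is_matching_def)
  ultimately show ?thesis
    using card_Union_matching[OF assms] assms(1) by (simp add: card_Diff_subset finite_subset)
qed

subsection \<open>The determinant expansion\<close>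

text \<open>A 2-cycle contributes -1 to the sign and \<open>a i j * a j i = - 1\<close> to the
  product, hence 1 in total; a fixed point contributes \<open>t\<close>. The induction peels off one
  orbit at a time. A general commutative ring allows polynomial entries.\<close>

lemma sign_prod_involution:
  fixes a :: "'a \<Rightarrow> 'a \<Rightarrow> 'b::comm_ring_1"
  assumes "finite V" "p \<in> involutions_on V"
    and "\<And>i. i \<in> V \<Longrightarrow> a i i = t"
    and "\<And>i j. i \<in> V \<Longrightarrow> j \<in> V \<Longrightarrow> i \<noteq> j \<Longrightarrow> a i j * a j i = - 1"
  shows "of_int (sign p) * (\<Prod>i\<in>V. a i (p i)) = t ^ card {i \<in> V. p i = i}"
  using assms
proof (induction V arbitrary: p rule: finite_psubset_induct)
  case (psubset V)
  have p: "p permutes V" "p (p x) = x" for x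
    using psubset.prems(1) by auto
  show ?case
  proof (cases "V = {}")
    case True
    then show ?thesis
      using p(1) by simp
  next
    case False
    then obtain i where i: "i \<in> V"
      by blast
    define j where "j = p i"
    have j: "j \<in> V" "p j = i"
      using p i by (simp_all add: j_def permutes_in_image)
    show ?thesis
    proof (cases "j = i")
      case True
      have "p permutes (V - {i})"
        by (rule permutes_superset[OF p(1)]) (use True j in auto)
      then have IH: "of_int (sign p) * (\<Prod>i\<in>V - {i}. a i (p i)) = t ^ card {x \<in> V - {i}. p x = x}"
        using psubset.IH[of "V - {i}" p] p(2) i psubset.prems by auto
      have "{x \<in> V. p x = x} = insert i {x \<in> V - {i}. p x = x}"
        using True i j by auto
      then have "card {x \<in> V. p x = x} = Suc (card {x \<in> V - {i}. p x = x})"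
        using psubset.hyps by simp
      moreover have "(\<Prod>i\<in>V. a i (p i)) = t * (\<Prod>i\<in>V - {i}. a i (p i))"
        using prod.remove[OF psubset.hyps i, of "\<lambda>i. a i (p i)"] True j psubset.prems(2)[OF i] by simp
      ultimately show ?thesis
        using IH by (simp add: mult.left_commute)
    next
      case False
      \<comment> \<open>Composing with the transposition undoes the cycle \<open>(i j)\<close>:
        \<open>q\<close> fixes both points, agrees with \<open>p\<close> on \<open>W\<close>, and
        has the opposite sign.\<close>
      define q where "q = Transposition.transpose i j \<circ> p"
      define W where "W = V - {i, j}"
      have px: "p x = i \<longleftrightarrow> x = j" "p x = j \<longleftrightarrow> x = i" for x
        using p(2) j_def by metis+
      have qx: "q x = (if x = i then i else if x = j then j else p x)" for x
        using px[of x] by (auto simp: q_def Transposition.transpose_def j_def[symmetric])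
      have q_V: "q permutes V"
        unfolding q_def by (intro permutes_compose p permutes_swap_id i j)
      have "q permutes W"
        by (rule permutes_superset[OF q_V]) (auto simp: W_def qx)
      moreover have "q (q x) = x" for x
        by (simp add: qx px p(2))
      ultimately have IH: "of_int (sign q) * (\<Prod>i\<in>W. a i (q i)) = t ^ card {x \<in> W. q x = x}"
        using psubset.IH[of W q] i psubset.prems by (auto simp: W_def)
      have p_q: "p = Transposition.transpose i j \<circ> q"
        by (simp add: q_def o_assoc[symmetric] fun_eq_iff)
      have "permutation q"
        using q_V psubset.hyps permutation_permutes by blast
      then have sign: "sign p = - sign q"
        unfolding p_q using False
        by (subst sign_compose) (simp_all add: permutation_swap_id sign_swap_id)
      have "(\<Prod>i\<in>V. a i (p i)) = a i j * (a j i * (\<Prod>i\<in>W. a i (p i)))"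
      proof -
        have V: "V = insert i (insert j W)" and "i \<notin> insert j W" "j \<notin> W" "finite W"
          using i j False psubset.hyps by (auto simp: W_def)
        then have "(\<Prod>k\<in>insert i (insert j W). a k (p k)) =
            a i (p i) * (a j (p j) * (\<Prod>k\<in>W. a k (p k)))"
          by simp
        then show ?thesis
          by (simp only: V[symmetric] j(2) j_def[symmetric])
      qed
      also have "\<dots> = - (\<Prod>i\<in>W. a i (p i))"
        using psubset.prems(3)[OF i j(1)] False by (simp add: mult.assoc[symmetric])
      also have "(\<Prod>i\<in>W. a i (p i)) = (\<Prod>i\<in>W. a i (q i))"
        by (rule prod.cong) (auto simp: W_def qx)
      finally have "(\<Prod>i\<in>V. a i (p i)) = - (\<Prod>i\<in>W. a i (q i))" .
      \<comment> \<open>The deleted points \<open>i\<close> and \<open>j\<close> were not fixed by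
        \<open>p\<close>, so the exponent of \<open>t\<close> is unchanged.\<close>
      moreover have "{x \<in> V. p x = x} = {x \<in> W. q x = x}"
      proof -
        have "p i \<noteq> i" "p j \<noteq> j"
          using False j(2) by (simp_all add: j_def[symmetric])
        then show ?thesis
          by (auto simp: W_def qx)
      qed
      ultimately show ?thesis
        using IH sign by simp
    qed
  qed
qed

section \<open>Seidel matrices as skew-symmetric sign matrices\<close>

text \<open>Eliminates tournaments, so that membership after an arc reversal becomes a check on
  matrix entries.\<close>

lemma seidel_matrices_eq:
  "seidel_matrices n = {S \<in> carrier_mat n n. (\<forall>i<n. S $$ (i, i) = 0) \<and>
     (\<forall>i<n. \<forall>j<n. i \<noteq> j \<longrightarrow> S $$ (i, j) \<in> {1, - 1} \<and> S $$ (j, i) = - S $$ (i, j))}" (is "_ = ?R")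
proof (intro equalityI subsetI)
  fix S assume "S \<in> seidel_matrices n"
  then obtain T where T: "tournament n T" "S = seidel_matrix n T"
    unfolding seidel_matrices_def by blast
  have arc: "((Suc i, Suc j) \<in> parcs T) \<noteq> ((Suc j, Suc i) \<in> parcs T)" if "i < n" "j < n" "i \<noteq> j" for i j
  proof -
    have "Suc i \<in> {1..n}" "Suc j \<in> {1..n}" "Suc i \<noteq> Suc j"
      using that by auto
    then show ?thesis
      using T(1) unfolding tournament_def by blast
  qed
  show "S \<in> ?R"
  proof (intro CollectI conjI allI impI)
    fix i j assume "i < n" "j < n" "i \<noteq> j"
    then show "S $$ (j, i) = - S $$ (i, j)"
      using arc[of i j] by (simp add: T(2) seidel_matrix_def)
  qed (simp_all add: T(2) seidel_matrix_def)
next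
  fix S assume S: "S \<in> ?R"
  then have diag: "\<forall>i<n. S $$ (i, i) = 0" and dim: "dim_row S = n" "dim_col S = n"
    by auto
  have off: "S $$ (i, j) = 1 \<or> S $$ (i, j) = - 1" and skew: "S $$ (j, i) = - S $$ (i, j)"
    if "i < n" "j < n" "i \<noteq> j" for i j
    using S that by blast+
  \<comment> \<open>The arcs are read off from the entries equal to 1. Vertices start at 1 and
    indices at 0, hence the shift, which never truncates on \<open>{1..n}\<close>.\<close>
  let ?A = "{(a, b). a \<in> {1..n} \<and> b \<in> {1..n} \<and> a \<noteq> b \<and> S $$ (a - 1, b - 1) = 1}"
  let ?T = "\<lparr> pverts = {1..n}, parcs = ?A \<rparr>"
  have fin: "finite ?A"
    by (rule finite_subset[of _ "{1..n} \<times> {1..n}"]) auto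
  have wf: "pair_wf_digraph ?T"
    by (rule pair_wf_digraph.intro) (simp_all add: case_prod_beta)
  have "pair_digraph ?T"
    by (intro pair_digraph.intro pair_fin_digraph.intro pair_fin_digraph_axioms.intro
      pair_loopfree_digraph.intro pair_loopfree_digraph_axioms.intro wf)
      (use fin in \<open>simp_all add: case_prod_beta\<close>)
  moreover have "((a, b) \<in> ?A) \<noteq> ((b, a) \<in> ?A)" if "a \<in> {1..n}" "b \<in> {1..n}" "a \<noteq> b" for a b
  proof -
    have "a - 1 < n" "b - 1 < n" "a - 1 \<noteq> b - 1"
      using that by auto
    then have "(S $$ (a - 1, b - 1) = 1) \<noteq> (S $$ (b - 1, a - 1) = 1)"
      using off[of "a - 1" "b - 1"] skew[of "a - 1" "b - 1"] by auto
    then show ?thesis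
      using that by simp
  qed
  ultimately have "tournament n ?T"
    unfolding tournament_def pair_pre_digraph.simps by blast
  moreover have "S = seidel_matrix n ?T"
    by (rule eq_matI) (use off diag dim in \<open>auto simp: seidel_matrix_def\<close>)
  ultimately show "S \<in> seidel_matrices n"
    unfolding seidel_matrices_def by blast
qed

lemma seidel_matricesD:
  assumes "S \<in> seidel_matrices n"
  shows "S \<in> carrier_mat n n"
    and "i < n \<Longrightarrow> S $$ (i, i) = 0"
    and "i < n \<Longrightarrow> j < n \<Longrightarrow> i \<noteq> j \<Longrightarrow> S $$ (i, j) * S $$ (j, i) = - 1"
proof -
  have S: "S \<in> carrier_mat n n" "\<forall>i<n. S $$ (i, i) = 0"
    "\<forall>i<n. \<forall>j<n. i \<noteq> j \<longrightarrow> S $$ (i, j) \<in> {1, - 1} \<and> S $$ (j, i) = - S $$ (i, j)"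
    using assms unfolding seidel_matrices_eq by blast+
  show "S \<in> carrier_mat n n" "i < n \<Longrightarrow> S $$ (i, i) = 0"
    using S by blast+
  assume "i < n" "j < n" "i \<noteq> j"
  then have "S $$ (i, j) \<in> {1, - 1}" "S $$ (j, i) = - S $$ (i, j)"
    using S(3) by blast+
  then show "S $$ (i, j) * S $$ (j, i) = - 1"
    by (elim insertE) simp_all
qed

section \<open>Arc reversal and the cancellation of non-involutions\<close>

text \<open>Comparing unordered pairs negates the entries at \<open>(i, j)\<close> and
  \<open>(j, i)\<close> together, which preserves skew-symmetry.\<close>

definition reverse_arc :: "nat \<Rightarrow> nat \<Rightarrow> real mat \<Rightarrow> real mat" where
  "reverse_arc i j S = mat (dim_row S) (dim_col S)
     (\<lambda>(a, b). if {a, b} = {i, j} then - S $$ (a, b) else S $$ (a, b))"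

lemma reverse_arc_index:
  assumes "S \<in> carrier_mat n n" "a < n" "b < n"
  shows "reverse_arc i j S $$ (a, b) = (if {a, b} = {i, j} then - S $$ (a, b) else S $$ (a, b))"
  using assms by (simp add: reverse_arc_def)

lemma reverse_arc_twice: "reverse_arc i j (reverse_arc i j S) = S"
  by (rule eq_matI) (auto simp: reverse_arc_def)

lemma reverse_arc_seidel:
  assumes "S \<in> seidel_matrices n" "i \<noteq> j"
  shows "reverse_arc i j S \<in> seidel_matrices n"
proof -
  have S: "S \<in> carrier_mat n n" "\<forall>i<n. S $$ (i, i) = 0"
    "\<forall>i<n. \<forall>j<n. i \<noteq> j \<longrightarrow> S $$ (i, j) \<in> {1, - 1} \<and> S $$ (j, i) = - S $$ (i, j)"
    using assms(1) unfolding seidel_matrices_eq by blast+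
  note R = reverse_arc_index[OF S(1)]
  show ?thesis
    unfolding seidel_matrices_eq
  proof (intro CollectI conjI allI impI)
    show "reverse_arc i j S \<in> carrier_mat n n"
      using S(1) by (simp add: reverse_arc_def)
    show "reverse_arc i j S $$ (a, a) = 0" if "a < n" for a
      using that S(2) by (simp add: R)
    fix a b assume ab: "a < n" "b < n" "a \<noteq> b"
    then have "S $$ (a, b) \<in> {1, - 1}" "S $$ (b, a) = - S $$ (a, b)"
      using S(3) by blast+
    then show "reverse_arc i j S $$ (a, b) \<in> {1, - 1}"
      "reverse_arc i j S $$ (b, a) = - reverse_arc i j S $$ (a, b)"
      using ab by (auto simp: R insert_commute[of b a])
  qed
qed

lemma char_poly_matrix_index:
  assumes "S \<in> carrier_mat n n" "i < n" "j < n"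
  shows "char_poly_matrix S $$ (i, j) = (if i = j then [:- S $$ (i, j), 1:] else [:- S $$ (i, j):])"
  using assms by (auto simp: char_poly_matrix_def)

text \<open>Reversing the arc between \<open>i\<close> and \<open>p i\<close> is an involution on
  the Seidel matrices that negates exactly one factor, the one in row \<open>i\<close>: row
  \<open>p i\<close> uses column \<open>p (p i)\<close>, which differs from
  \<open>i\<close>.\<close>

lemma sum_seidel_noninvolution:
  assumes p: "p permutes {0..<n}" and i: "p (p i) \<noteq> i"
  shows "(\<Sum>S\<in>seidel_matrices n. \<Prod>j = 0..<n. char_poly_matrix S $$ (j, p j)) = 0" (is "sum ?f _ = 0")
proof -
  \<comment> \<open>A fixed point would satisfy \<open>p (p i) = i\<close>, and every point outside
    the range is fixed.\<close>
  have ij: "p i \<noteq> i" "i \<in> {0..<n}"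
    using i p by (auto simp: permutes_not_in intro: ccontr)
  let ?r = "reverse_arc i (p i)"
  have neg: "?f (?r S) = - ?f S" if S: "S \<in> seidel_matrices n" for S
  proof -
    note cS = seidel_matricesD(1)[OF S]
    have cr: "?r S \<in> carrier_mat n n"
      using cS by (simp add: reverse_arc_def)
    have pj: "p j < n" if "j < n" for j
      using permutes_in_image[OF p, of j] that by simp
    have "char_poly_matrix (?r S) $$ (i, p i) = - char_poly_matrix S $$ (i, p i)"
      using ij pj[of i] cS
      by (simp add: char_poly_matrix_index[OF cr] char_poly_matrix_index[OF cS]
            reverse_arc_index[OF cS])
    moreover have "char_poly_matrix (?r S) $$ (j, p j) = char_poly_matrix S $$ (j, p j)"
      if "j \<in> {0..<n} - {i}" for j
    proof -
      \<comment> \<open>As \<open>j \<noteq> i\<close>, equality would force \<open>j = p i\<close>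
        and \<open>p j = i\<close>, contradicting \<open>p (p i) \<noteq> i\<close>.\<close>
      have "{j, p j} \<noteq> {i, p i}"
        using that i by (auto simp: doubleton_eq_iff)
      then show ?thesis
        using that pj[of j] cS
        by (simp add: char_poly_matrix_index[OF cr] char_poly_matrix_index[OF cS]
            reverse_arc_index[OF cS])
    qed
    ultimately show ?thesis
      using prod.remove[OF _ ij(2), of "\<lambda>j. char_poly_matrix (?r S) $$ (j, p j)"]
        prod.remove[OF _ ij(2), of "\<lambda>j. char_poly_matrix S $$ (j, p j)"] by simp
  qed
  \<comment> \<open>Reindexing along the reversal shows that the sum equals its own
    negative.\<close>
  have "sum ?f (seidel_matrices n) = (\<Sum>S\<in>seidel_matrices n. ?f (?r S))"
    by (rule sum.reindex_bij_witness[of _ ?r ?r])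
      (use ij in \<open>auto simp: reverse_arc_twice reverse_arc_seidel\<close>)
  also have "\<dots> = - sum ?f (seidel_matrices n)"
    by (simp add: neg sum_negf)
  finally show ?thesis
    by simp
qed

text \<open>\<open>sign_prod_involution\<close> with the entries of xI - S and \<open>t\<close> = x.
  The result does not depend on \<open>S\<close>, so averaging will leave it unchanged.\<close>

lemma seidel_involution_term:
  assumes S: "S \<in> seidel_matrices n" and p: "p \<in> involutions_on {0..<n}"
  shows "signof p * (\<Prod>j = 0..<n. char_poly_matrix S $$ (j, p j)) =
    Polynomial.monom 1 (card {i \<in> {0..<n}. p i = i})"
proof -
  note cS = seidel_matricesD(1)[OF S]
  have "signof p * (\<Prod>j = 0..<n. char_poly_matrix S $$ (j, p j)) =
      [:0, 1:] ^ card {i \<in> {0..<n}. p i = i}"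
  proof (rule sign_prod_involution[OF _ p])
    fix i j assume "i \<in> {0..<n}" "j \<in> {0..<n}" "i \<noteq> j"
    \<comment> \<open>The off-diagonal entries are constants with a minus sign each, and the two
      signs cancel in the product.\<close>
    then show "char_poly_matrix S $$ (i, j) * char_poly_matrix S $$ (j, i) = - 1"
      using seidel_matricesD(3)[OF S, of i j]
      by (simp add: char_poly_matrix_index[OF cS] one_pCons mult.commute)
  qed (use seidel_matricesD(2)[OF S] in \<open>simp_all add: char_poly_matrix_index[OF cS]\<close>)
  then show ?thesis
    by (simp add: monom_altdef)
qed

section \<open>Averaging the characteristic polynomial\<close>

text \<open>After exchanging the sums, each non-involution vanishes and each involution gives the
  same monomial for every Seidel matrix, hence the factor
  \<open>card (seidel_matrices n)\<close>.\<close>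

lemma sum_char_poly_seidel:
  "(\<Sum>S\<in>seidel_matrices n. char_poly S) =
    of_nat (card (seidel_matrices n)) *
      (\<Sum>p\<in>involutions_on {0..<n}. Polynomial.monom 1 (card {i \<in> {0..<n}. p i = i}))"
proof -
  let ?t = "\<lambda>S p. \<Prod>j = 0..<n. char_poly_matrix S $$ (j, p j)"
  have "(\<Sum>S\<in>seidel_matrices n. char_poly S) =
      (\<Sum>S\<in>seidel_matrices n. \<Sum>p | p permutes {0..<n}. signof p * ?t S p)"
    by (rule sum.cong[OF refl])
      (simp add: char_poly_def det_def'[OF char_poly_matrix_closed[OF seidel_matricesD(1)]])
  also have "\<dots> = (\<Sum>p | p permutes {0..<n}. \<Sum>S\<in>seidel_matrices n. signof p * ?t S p)"
    by (rule sum.swap)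
  also have "\<dots> = (\<Sum>p\<in>involutions_on {0..<n}. \<Sum>S\<in>seidel_matrices n. signof p * ?t S p)"
  proof (rule sum.mono_neutral_right)
    show "\<forall>p\<in>{p. p permutes {0..<n}} - involutions_on {0..<n}.
        (\<Sum>S\<in>seidel_matrices n. signof p * ?t S p) = 0"
      using sum_seidel_noninvolution by (auto simp flip: sum_distrib_left)
  qed (auto simp: finite_permutations)
  also have "\<dots> = (\<Sum>p\<in>involutions_on {0..<n}. \<Sum>S\<in>seidel_matrices n.
      Polynomial.monom 1 (card {i \<in> {0..<n}. p i = i}))"
    by (intro sum.cong[OF refl] seidel_involution_term)
  also have "\<dots> = of_nat (card (seidel_matrices n)) *
      (\<Sum>p\<in>involutions_on {0..<n}. Polynomial.monom 1 (card {i \<in> {0..<n}. p i = i}))"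
    by (simp add: sum_distrib_left)
  finally show ?thesis .
qed

lemma expected_char_poly_matchings:
  "expected_poly (random_seidel n) char_poly =
    (\<Sum>M\<in>matchings_on {0..<n}. Polynomial.monom 1 (n - 2 * card M))"
proof -
  have "expected_poly (random_seidel n) char_poly =
      Polynomial.smult (1 / card (seidel_matrices n)) (\<Sum>S\<in>seidel_matrices n. char_poly S)"
    using finite_seidel_matrices[of n] seidel_matrices_nonempty[of n]
    by (simp add: expected_poly_def random_seidel_def smult_sum2)
  also have "\<dots> = (\<Sum>p\<in>involutions_on {0..<n}. Polynomial.monom 1 (card {i \<in> {0..<n}. p i = i}))"
    using finite_seidel_matrices[of n] seidel_matrices_nonempty[of n]
    by (simp add: sum_char_poly_seidel of_nat_poly)
  also have "\<dots> = (\<Sum>M\<in>matchings_on {0..<n}.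
      Polynomial.monom 1 (card {i \<in> {0..<n}. matching_involution M i = i}))"
    by (rule sum.reindex_bij_betw[OF bij_betw_matching_involution, symmetric])
  also have "\<dots> = (\<Sum>M\<in>matchings_on {0..<n}. Polynomial.monom 1 (n - 2 * card M))"
    by (rule sum.cong[OF refl], subst card_fixed_matching_involution) simp_all
  finally show ?thesis .
qed

text \<open>Groups the matchings by size, which is at most \<open>n div 2\<close>, and counts each
  group.\<close>

lemma expected_char_poly:
  "expected_poly (random_seidel n) char_poly =
    (\<Sum>k\<le>n div 2. Polynomial.monom
      (real ((n choose (2 * k)) * double_fact (2 * int k - 1))) (n - 2 * k))"
proof -
  let ?V = "{0..<n}"
  have "card ` matchings_on ?V \<subseteq> {..n div 2}"
    using card_matching_le[of ?V] by fastforce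
  then have "expected_poly (random_seidel n) char_poly =
      (\<Sum>k\<le>n div 2. \<Sum>M | M \<in> matchings_on ?V \<and> card M = k. Polynomial.monom 1 (n - 2 * card M))"
    unfolding expected_char_poly_matchings
    by (intro sum.group[symmetric] finite_matchings_on) simp_all
  also have "\<dots> = (\<Sum>k\<le>n div 2. Polynomial.monom
      (real (card {M \<in> matchings_on ?V. card M = k})) (n - 2 * k))"
    by (intro sum.cong[OF refl]) (simp add: of_nat_poly smult_monom)
  also have "\<dots> = (\<Sum>k\<le>n div 2. Polynomial.monom
      (real ((n choose (2 * k)) * double_fact (2 * int k - 1))) (n - 2 * k))"
    by (subst card_matchings_on) simp_all
  finally show ?thesis .
qed

text \<open>Finite support turns the integral into a finite sum, with which taking a coefficient
  commutes. This links the scalar expectations to the polynomial one.\<close>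

lemma expectation_coeff:
  assumes "finite (set_pmf p)"
  shows "measure_pmf.expectation p (\<lambda>\<omega>. Polynomial.coeff (f \<omega>) m) =
    Polynomial.coeff (expected_poly p f) m"
  using assms
  by (simp add: expected_poly_def coeff_sum integral_measure_pmf[where A = "set_pmf p"] mult.commute)

theorem theorem7p7:
  fixes n :: nat
  assumes "n > 0"
  shows "(\<forall>k \<le> n div 2.
      measure_pmf.expectation (random_seidel n) (\<lambda>S. Polynomial.coeff (char_poly S) (n - 2 * k))
        = real (card {M. is_matching (complete_graph_edges n) M \<and> card M = k})
    \<and> card {M. is_matching (complete_graph_edges n) M \<and> card M = k}
        = (n choose (2 * k)) * double_fact (2 * int k - 1))
    \<and> expected_poly (random_seidel n) char_poly
        = (\<Sum>k\<le>n div 2. Polynomial.monom (real ((n choose (2 * k)) * double_fact (2 * int k - 1))) (n - 2 * k))"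
proof (intro conjI allI impI expected_char_poly)
  fix k assume k: "k \<le> n div 2"
  let ?c = "\<lambda>k. (n choose (2 * k)) * double_fact (2 * int k - 1)"
  show count: "card {M. is_matching (complete_graph_edges n) M \<and> card M = k} = ?c k"
    \<comment> \<open>The count depends only on the number of vertices, so \<open>{1..n}\<close>
      here and \<open>{0..<n}\<close> in the expansion give the same value.\<close>
    using card_matchings_on[of "{1..n}" k] by (simp add: complete_graph_edges_def)
  have "finite (set_pmf (random_seidel n))"
    using finite_seidel_matrices seidel_matrices_nonempty by (simp add: random_seidel_def)
  then have "measure_pmf.expectation (random_seidel n)
      (\<lambda>S. Polynomial.coeff (char_poly S) (n - 2 * k)) =
      (\<Sum>l\<le>n div 2. if n - 2 * l = n - 2 * k then real (?c l) else 0)"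
    by (simp add: expectation_coeff expected_char_poly coeff_sum del: of_nat_mult)
  \<comment> \<open>Both \<open>2 * l\<close> and \<open>2 * k\<close> are at most \<open>n\<close>,
    so the subtractions do not truncate and equal exponents force \<open>l = k\<close>.\<close>
  also have "\<dots> = (\<Sum>l\<le>n div 2. if l = k then real (?c l) else 0)"
    using k by (intro sum.cong[OF refl]) auto
  also have "\<dots> = real (?c k)"
    using k by simp
  finally show "measure_pmf.expectation (random_seidel n)
      (\<lambda>S. Polynomial.coeff (char_poly S) (n - 2 * k)) =
      real (card {M. is_matching (complete_graph_edges n) M \<and> card M = k})"
    by (simp only: count)
qed

end
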